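(* Let $u:\mathbb{R}_+\to\mathbb{R}$ be a piecewise continuous function that is of persistent excitation (PE), with constants $T>0$ and $\epsilon>0$. Let $0\le p<1$ and consider the scalar system ($n=1$) $$\dot{x}(t)=-\lceil u(t)x(t)\rfloor^{p}\,u(t),\qquad x(t)\in\mathbb{R}.$$ Then the origin $x=0$ is globally uniformly finite-time stable. Moreover, for a trajectory with initial time $t_0\ge 0$ and initial value $x(t_0)=x_0$, an upper bound of the convergence time is $$\mathbf{T}(x_0)\le\left\lceil \frac{|x(t_0)|^{1-p}}{(1-p)\,T\,\epsilon^{p+1}}\right\rceil\cdot T ,$$ that is, $x(t)=0$ for all $t\ge t_0+\left\lceil \frac{|x(t_0)|^{1-p}}{(1-p)T\epsilon^{p+1}}\right\rceil T$. Here $\lceil\cdot\rceil$ denotes the ceiling function.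
   Context: Notation: for $w\in\mathbb{R}$ and an exponent $p\ge 0$, $\lceil w\rfloor^p:=|w|^p\,\mathrm{sign}(w)$, with $\mathrm{sign}(0)=0$ (this is different from the ceiling function $\lceil\cdot\rceil$). Solutions are absolutely continuous functions satisfying the differential equation for almost every $t\ge t_0$. Persistent excitation (PE): a piecewise continuous $u:\mathbb{R}_+\to\mathbb{R}^n$ is of PE if there exist $T>0$ and $\epsilon>0$ such that $\frac{1}{T}\int_{t}^{t+T}|u^T(s)w|\,ds\ge\epsilon$ for all $t\ge 0$ and all $w\in\mathbb{R}^n$ with $\|w\|=1$. For $n=1$ this reads $\frac1T\int_t^{t+T}|u(s)|\,ds\ge\epsilon$ for all $t\ge 0$. Globally uniformly finite-time stable: for a system $\dot x=f(x,t)$ on $\mathbb{R}^n$ with $f(0,t)=0$ for all $t$, the point $x=0$ is globally uniformly finite-time stable if it is uniformly stable and for any $x_0\in\mathbb{R}^n$ there exists $0\le\mathbf{T}(x_0)<+\infty$ (independent of $t_0$) such that the solution satisfies $x(t,t_0,x_0)=0$ for all $t\ge t_0+\mathbf{T}(x_0)$. *)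

theory Defs
  imports "HOL-Analysis.Analysis"
begin

text \<open>For \<open>p = 0\<close> this is the sign function, with value \<open>0\<close> at \<open>w = 0\<close>.\<close>

definition signed_powr :: "real \<Rightarrow> real \<Rightarrow> real" where
  "signed_powr w p = \<bar>w\<bar> powr p * sgn w"

text \<open>Functions on the half-line \<open>t \<ge> 0\<close> are total functions on the reals whose values at
  negative arguments are ignored. On every bounded interval there are only finitely many
  exceptional points, and the one-sided limits exist there (at \<open>0\<close> only the right one).\<close>

definition piecewise_continuous :: "(real \<Rightarrow> 'a::topological_space) \<Rightarrow> bool" where
  "piecewise_continuous u \<longleftrightarrow>
     (\<forall>b>0. \<exists>S. finite S \<and> S \<subseteq> {0..b} \<and>
        (\<forall>t\<in>{0..b} - S. continuous (at t within {0..}) u) \<and>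
        (\<forall>t\<in>S. (\<exists>l. (u \<longlongrightarrow> l) (at_right t)) \<and>
                (t > 0 \<longrightarrow> (\<exists>l. (u \<longlongrightarrow> l) (at_left t)))))"

definition persistently_exciting_with ::
    "(real \<Rightarrow> 'a::euclidean_space) \<Rightarrow> real \<Rightarrow> real \<Rightarrow> bool" where
  "persistently_exciting_with u T \<epsilon> \<longleftrightarrow>
     piecewise_continuous u \<and> T > 0 \<and> \<epsilon> > 0 \<and>
     (\<forall>t\<ge>0. \<forall>w. norm w = 1 \<longrightarrow>
        (1 / T) * integral {t..t + T} (\<lambda>s. \<bar>u s \<bullet> w\<bar>) \<ge> \<epsilon>)"

text \<open>The members of a division are nonempty compact intervals with pairwise disjoint
  interiors; \<open>Inf K\<close> and \<open>Sup K\<close> are the endpoints of \<open>K\<close>.\<close>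

definition absolutely_continuous_on ::
    "real set \<Rightarrow> (real \<Rightarrow> 'a::real_normed_vector) \<Rightarrow> bool" where
  "absolutely_continuous_on I x \<longleftrightarrow>
     (\<forall>e>0. \<exists>d>0. \<forall>D. D division_of \<Union>D \<and> \<Union>D \<subseteq> I \<and> (\<Sum>K\<in>D. Sup K - Inf K) < d \<longrightarrow>
        (\<Sum>K\<in>D. norm (x (Sup K) - x (Inf K))) < e)"

text \<open>Solutions of \<open>x' = f x t\<close> in the sense of Caratheodory on the half-line \<open>t \<ge> t0\<close>;
  absolute continuity is required on compact intervals.\<close>

definition is_solution ::
    "('a::euclidean_space \<Rightarrow> real \<Rightarrow> 'a) \<Rightarrow> real \<Rightarrow> 'a \<Rightarrow> (real \<Rightarrow> 'a) \<Rightarrow> bool" where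
  "is_solution f t0 x0 x \<longleftrightarrow>
     x t0 = x0 \<and>
     (\<forall>b\<ge>t0. absolutely_continuous_on {t0..b} x) \<and>
     (AE t in lebesgue. t \<ge> t0 \<longrightarrow>
        (x has_vector_derivative f (x t) t) (at t within {t0..}))"

definition uniformly_stable :: "('a::euclidean_space \<Rightarrow> real \<Rightarrow> 'a) \<Rightarrow> bool" where
  "uniformly_stable f \<longleftrightarrow>
     (\<forall>e>0. \<exists>d>0. \<forall>t0\<ge>0. \<forall>x0 x. norm x0 < d \<and> is_solution f t0 x0 x \<longrightarrow>
        (\<forall>t\<ge>t0. norm (x t) < e))"

text \<open>Speaking of ``the solution'' presupposes that there is one for all \<open>t \<ge> t0\<close>. This is made
  explicit so that the other clauses, which concern every solution, are not vacuous.\<close>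

definition globally_uniformly_finite_time_stable ::
    "('a::euclidean_space \<Rightarrow> real \<Rightarrow> 'a) \<Rightarrow> bool" where
  "globally_uniformly_finite_time_stable f \<longleftrightarrow>
     (\<forall>t\<ge>0. f 0 t = 0) \<and>
     (\<forall>t0\<ge>0. \<forall>x0. \<exists>x. is_solution f t0 x0 x) \<and>
     uniformly_stable f \<and>
     (\<forall>x0. \<exists>\<tau>\<ge>0. \<forall>t0\<ge>0. \<forall>x. is_solution f t0 x0 x \<longrightarrow> (\<forall>t\<ge>t0 + \<tau>. x t = 0))"

end

theory Submission
  imports Defs
begin

text \<open>The right-hand side equals \<open>- \<bar>u\<bar> powr (p + 1) * \<bar>x\<bar> powr p * sgn x\<close>, so the equation separates:
  as long as \<open>x\<close> does not vanish, \<open>W = \<bar>x\<bar> powr (1 - p)\<close> satisfies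
  \<open>W' = - (1 - p) * \<bar>u\<bar> powr (p + 1)\<close>. Hence \<open>\<bar>x\<bar>\<close> decreases and zero is absorbing. By Jensen's
  inequality, persistent excitation makes \<open>W\<close> lose at least \<open>(1 - p) * T * \<epsilon> powr (p + 1)\<close> over
  each period \<open>T\<close>, which bounds the number of periods before \<open>x\<close> vanishes. Passing from the
  differential equation to \<open>W\<close> uses the fundamental theorem of calculus for absolutely
  continuous functions.\<close>

subsection \<open>Absolutely continuous functions\<close>

lemma division_of_endpoints:
  fixes K :: "real set"
  assumes "D division_of S" "K \<in> D"
  shows "K = {Inf K..Sup K}" "Inf K \<le> Sup K" "Inf K \<in> S" "Sup K \<in> S"
proof -
  obtain a b where ab: "K = {a..b}" "K \<noteq> {}" "K \<subseteq> S"
    using division_ofD(2,3,4)[OF assms(1) assms(2)] by (auto simp: box_real)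
  then have "a \<le> b" by auto
  then show "K = {Inf K..Sup K}" "Inf K \<le> Sup K" "Inf K \<in> S" "Sup K \<in> S"
    using ab by auto
qed

lemma absolutely_continuous_onE:
  assumes "absolutely_continuous_on I x" "e > 0"
  obtains d where "d > 0" "\<And>D. D division_of \<Union>D \<Longrightarrow> \<Union>D \<subseteq> I \<Longrightarrow>
      (\<Sum>K\<in>D. Sup K - Inf K) < d \<Longrightarrow> (\<Sum>K\<in>D. norm (x (Sup K) - x (Inf K))) < e"
proof -
  from assms(1)[unfolded absolutely_continuous_on_def, rule_format, OF assms(2)]
  obtain d where "d > 0" and d: "\<forall>D. D division_of \<Union>D \<and> \<Union>D \<subseteq> I \<and> (\<Sum>K\<in>D. Sup K - Inf K) < d \<longrightarrow>
        (\<Sum>K\<in>D. norm (x (Sup K) - x (Inf K))) < e"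
    by (elim exE conjE)
  show ?thesis
    by (rule that[OF \<open>d > 0\<close>]) (rule d[rule_format], intro conjI)
qed

lemma absolutely_continuous_on_subset:
  "absolutely_continuous_on I x \<Longrightarrow> J \<subseteq> I \<Longrightarrow> absolutely_continuous_on J x"
  unfolding absolutely_continuous_on_def by (meson order_trans)

lemma absolutely_continuous_on_id: "absolutely_continuous_on I (\<lambda>t. t)"
  unfolding absolutely_continuous_on_def
proof (intro allI impI)
  fix e :: real assume "e > 0"
  show "\<exists>d>0. \<forall>D. D division_of \<Union>D \<and> \<Union>D \<subseteq> I \<and> (\<Sum>K\<in>D. Sup K - Inf K) < d \<longrightarrow>
          (\<Sum>K\<in>D. norm (Sup K - Inf K)) < e"
  proof (intro exI[of _ e] conjI allI impI \<open>e > 0\<close>, elim conjE)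
    fix D :: "real set set"
    assume D: "D division_of \<Union>D" "(\<Sum>K\<in>D. Sup K - Inf K) < e"
    have "(\<Sum>K\<in>D. norm (Sup K - Inf K)) = (\<Sum>K\<in>D. Sup K - Inf K)"
      using division_of_endpoints(2)[OF D(1)] by (intro sum.cong) auto
    then show "(\<Sum>K\<in>D. norm (Sup K - Inf K)) < e" using D(2) by simp
  qed
qed

text \<open>Each increment of the composition is at most \<open>L\<close> times the increment of
  \<open>x\<close>. The Lipschitz condition is imposed on the image of \<open>x\<close> only, which
  admits powers that are Lipschitz merely away from zero or on a half-line.\<close>

lemma absolutely_continuous_on_compose_lipschitz:
  assumes x: "absolutely_continuous_on I x" and g: "L-lipschitz_on (x ` I) g"
  shows "absolutely_continuous_on I (\<lambda>t. g (x t))"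
  unfolding absolutely_continuous_on_def
proof (intro allI impI)
  fix e :: real assume "e > 0"
  have L: "L \<ge> 0" using g by (rule lipschitz_on_nonneg)
  \<comment> \<open>The constant \<open>L\<close> may be zero; dividing by \<open>L + 1\<close>
    stays meaningful and makes the final estimate strict.\<close>
  then have "e / (L + 1) > 0" using \<open>e > 0\<close> by simp
  from absolutely_continuous_onE[OF x this]
  obtain d where d: "d > 0" "\<And>D. D division_of \<Union>D \<Longrightarrow> \<Union>D \<subseteq> I \<Longrightarrow>
      (\<Sum>K\<in>D. Sup K - Inf K) < d \<Longrightarrow> (\<Sum>K\<in>D. norm (x (Sup K) - x (Inf K))) < e / (L + 1)"
    by blast
  show "\<exists>d>0. \<forall>D. D division_of \<Union>D \<and> \<Union>D \<subseteq> I \<and> (\<Sum>K\<in>D. Sup K - Inf K) < d \<longrightarrow>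
          (\<Sum>K\<in>D. norm (g (x (Sup K)) - g (x (Inf K)))) < e"
  proof (intro exI[of _ d] conjI allI impI \<open>d > 0\<close>, elim conjE)
    fix D :: "real set set"
    assume D: "D division_of \<Union>D" "\<Union>D \<subseteq> I" "(\<Sum>K\<in>D. Sup K - Inf K) < d"
    have "(\<Sum>K\<in>D. norm (g (x (Sup K)) - g (x (Inf K))))
        \<le> (\<Sum>K\<in>D. L * norm (x (Sup K) - x (Inf K)))"
    proof (rule sum_mono)
      fix K assume "K \<in> D"
      then have "Sup K \<in> I" "Inf K \<in> I"
        using division_of_endpoints(3,4)[OF D(1) \<open>K \<in> D\<close>] D(2) by (auto dest: subsetD)
      then show "norm (g (x (Sup K)) - g (x (Inf K))) \<le> L * norm (x (Sup K) - x (Inf K))"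
        using lipschitz_onD[OF g, of "x (Sup K)" "x (Inf K)"] by (simp add: dist_norm)
    qed
    also have "\<dots> = L * (\<Sum>K\<in>D. norm (x (Sup K) - x (Inf K)))"
      by (simp add: sum_distrib_left)
    also have "\<dots> \<le> L * (e / (L + 1))"
      using d(2)[OF D] L by (intro mult_left_mono) auto
    also have "\<dots> < e" using L \<open>e > 0\<close> by (simp add: field_simps)
    finally show "(\<Sum>K\<in>D. norm (g (x (Sup K)) - g (x (Inf K)))) < e" .
  qed
qed

lemma lipschitz_imp_absolutely_continuous_on:
  "L-lipschitz_on I x \<Longrightarrow> absolutely_continuous_on I x"
  using absolutely_continuous_on_compose_lipschitz[OF absolutely_continuous_on_id, of L I x] by simp

lemma absolutely_continuous_on_imp_continuous_on:
  assumes "absolutely_continuous_on {a..b} x"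
  shows "continuous_on {a..b} x"
  unfolding continuous_on_iff
proof (intro ballI allI impI)
  fix t e :: real assume t: "t \<in> {a..b}" "e > 0"
  obtain d where d: "d > 0" "\<And>D. D division_of \<Union>D \<Longrightarrow> \<Union>D \<subseteq> {a..b} \<Longrightarrow>
      (\<Sum>K\<in>D. Sup K - Inf K) < d \<Longrightarrow> (\<Sum>K\<in>D. norm (x (Sup K) - x (Inf K))) < e"
    by (rule absolutely_continuous_onE[OF assms t(2)]) blast
  show "\<exists>d>0. \<forall>s\<in>{a..b}. dist s t < d \<longrightarrow> dist (x s) (x t) < e"
  proof (intro exI[of _ d] conjI ballI impI \<open>d > 0\<close>)
    fix s assume s: "s \<in> {a..b}" "dist s t < d"
    let ?D = "{cbox (min s t) (max s t)}"
    have "?D division_of cbox (min s t) (max s t)" by (rule division_of_self) auto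
    then have "?D division_of \<Union>?D" by simp
    moreover have "\<Union>?D \<subseteq> {a..b}" using s t by auto
    moreover have "(\<Sum>K\<in>?D. Sup K - Inf K) < d" using s by (auto simp: dist_real_def min_def max_def)
    ultimately have "(\<Sum>K\<in>?D. norm (x (Sup K) - x (Inf K))) < e" by (rule d(2))
    then show "dist (x s) (x t) < e"
      by (auto simp: dist_norm min_def max_def norm_minus_commute split: if_splits)
  qed
qed

section \<open>Increments over small open sets and the fundamental theorem of calculus\<close>

lemma negligible_outer_open:
  fixes N :: "real set"
  assumes "negligible N" "d > 0"
  obtains U where "open U" "N \<subseteq> U" "U \<in> lmeasurable" "measure lebesgue U < d"
proof -
  have N: "N \<in> lmeasurable" "measure lebesgue N = 0"
    using assms(1) negligible_imp_measurable negligible_imp_measure0 by blast+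
  obtain U where U: "open U" "N \<subseteq> U" "U - N \<in> lmeasurable" "emeasure lebesgue (U - N) < ennreal d"
    using sets_lebesgue_outer_open[OF fmeasurableD[OF N(1)] \<open>d > 0\<close>] by metis
  have eq: "U = N \<union> (U - N)" using U by auto
  have "U \<in> lmeasurable" by (subst eq) (rule fmeasurable.Un[OF N(1) U(3)])
  moreover have "measure lebesgue U \<le> measure lebesgue N + measure lebesgue (U - N)"
    by (subst eq) (rule measure_Un_le[OF fmeasurableD[OF N(1)] fmeasurableD[OF U(3)]])
  moreover have "measure lebesgue (U - N) < d"
    using U(3,4) \<open>d > 0\<close> by (simp add: emeasure_eq_measure2 ennreal_less_iff)
  ultimately show ?thesis using that U N(2) by simp
qed

text \<open>Take \<open>U\<close> with measure below the threshold that absolute continuity assigns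
  to \<open>e\<close>. Non-overlapping intervals inside \<open>U\<close> have total length at most
  the measure of \<open>U\<close>, so their increments sum to less than \<open>e\<close>. Tagged
  partial divisions are the form in which the intervals with tags in \<open>N\<close> arise from a
  gauge-fine division.\<close>

lemma absolutely_continuous_sum_on_open:
  fixes F :: "real \<Rightarrow> 'a::real_normed_vector"
  assumes F: "absolutely_continuous_on {a..b} F" and "negligible N" "e > 0"
  obtains U where "open U" "N \<subseteq> U"
    "\<And>q. q tagged_partial_division_of {a..b} \<Longrightarrow> (\<And>t K. (t, K) \<in> q \<Longrightarrow> K \<subseteq> U) \<Longrightarrow>
       (\<Sum>(t,K)\<in>q. norm (F (Sup K) - F (Inf K))) < e"
proof -
  obtain d where d: "d > 0" "\<And>D. D division_of \<Union>D \<Longrightarrow> \<Union>D \<subseteq> {a..b} \<Longrightarrow>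
      (\<Sum>K\<in>D. Sup K - Inf K) < d \<Longrightarrow> (\<Sum>K\<in>D. norm (F (Sup K) - F (Inf K))) < e"
    by (rule absolutely_continuous_onE[OF F \<open>e > 0\<close>]) blast
  obtain U where U: "open U" "N \<subseteq> U" "U \<in> lmeasurable" "measure lebesgue U < d"
    using negligible_outer_open[OF \<open>negligible N\<close> d(1)] by metis
  show ?thesis
  proof (rule that[OF U(1,2)])
    fix q assume q: "q tagged_partial_division_of {a..b}" and qU: "\<And>t K. (t, K) \<in> q \<Longrightarrow> K \<subseteq> U"
    let ?D = "snd ` q"
    note q_tag = tagged_partial_division_of_Union_self[OF q]
    have D: "?D division_of \<Union>?D" by (rule partial_division_of_tagged_division[OF q])
    have sub: "\<Union>?D \<subseteq> {a..b}" "\<Union>?D \<subseteq> U"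
      using tagged_partial_division_ofD(3)[OF q] qU by (fastforce simp: image_iff)+
    have "(\<Sum>K\<in>?D. Sup K - Inf K) = (\<Sum>K\<in>?D. measure lebesgue K)"
    proof (intro sum.cong refl)
      fix K assume "K \<in> ?D"
      note K = division_of_endpoints(1,2)[OF D this]
      have "measure lebesgue {Inf K..Sup K} = Sup K - Inf K"
        using K(2) by simp
      then show "Sup K - Inf K = measure lebesgue K"
        using K(1) by simp
    qed
    also have "\<dots> = measure lebesgue (\<Union>?D)" by (rule content_division[OF D])
    also have "\<dots> \<le> measure lebesgue U"
      using sub U D by (intro measure_mono_fmeasurable) (auto intro: lmeasurable_division fmeasurableD)
    finally have "(\<Sum>K\<in>?D. norm (F (Sup K) - F (Inf K))) < e"
      using U(4) by (intro d(2)[OF D sub(1)]) simp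
    moreover have "(\<Sum>(t,K)\<in>q. norm (F (Sup K) - F (Inf K))) = (\<Sum>K\<in>?D. norm (F (Sup K) - F (Inf K)))"
    proof -
      \<comment> \<open>Two tags can share a member only if it has empty interior. The increment
        over a single point is zero, and the value at the empty set, which has no meaningful
        endpoints, is set to zero, so passing from pairs to intervals does not change the
        sum.\<close>
      let ?h = "\<lambda>K::real set. if K = {} then 0 else norm (F (Sup K) - F (Inf K))"
      have "(\<Sum>(t,K)\<in>q. norm (F (Sup K) - F (Inf K))) = (\<Sum>(t,K)\<in>q. ?h K)"
        using tagged_partial_division_ofD(2)[OF q] by (intro sum.cong) fastforce+
      also have "\<dots> = (\<Sum>K\<in>?D. ?h K)"
        by (rule sum.over_tagged_division_lemma[OF q_tag]) auto
      also have "\<dots> = (\<Sum>K\<in>?D. norm (F (Sup K) - F (Inf K)))"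
        using division_ofD(3)[OF D] by (intro sum.cong) auto
      finally show ?thesis .
    qed
    ultimately show "(\<Sum>(t,K)\<in>q. norm (F (Sup K) - F (Inf K))) < e" by simp
  qed
qed

text \<open>At tags in the null set the gauge is an open set of small measure, where absolute
  continuity controls the increments of \<open>F\<close>; elsewhere it comes from differentiability.\<close>

theorem fundamental_theorem_of_calculus_absolutely_continuous:
  fixes F :: "real \<Rightarrow> 'a::real_normed_vector"
  assumes "a \<le> b" and F: "absolutely_continuous_on {a..b} F" and N: "negligible N"
    and deriv: "\<And>t. t \<in> {a..b} - N \<Longrightarrow> (F has_vector_derivative f t) (at t within {a..b})"
  shows "(f has_integral (F b - F a)) {a..b}"
proof (rule has_integral_spike[OF N])
  \<comment> \<open>With the integrand set to zero on \<open>N\<close>, a tag in \<open>N\<close>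
    contributes only the increment of \<open>F\<close>.\<close>
  let ?f = "\<lambda>t. if t \<in> N then 0 else f t"
  show "f t = ?f t" if "t \<in> {a..b} - N" for t using that by simp
  show "(?f has_integral (F b - F a)) {a..b}"
    unfolding has_integral_real
  proof (intro allI impI)
    fix e :: real assume "e > 0"
    \<comment> \<open>Half of \<open>e\<close> is reserved for tags outside \<open>N\<close>, whose
      errors add up to at most \<open>c * (b - a)\<close>; the summand 1 covers
      \<open>a = b\<close>.\<close>
    define c where "c = e / (2 * (b - a + 1))"
    have "c > 0" using \<open>e > 0\<close> \<open>a \<le> b\<close> by (simp add: c_def)
    have c_bound: "c * (b - a) < e / 2" using \<open>e > 0\<close> \<open>a \<le> b\<close> by (simp add: c_def field_simps)
    obtain U where U: "open U" "N \<subseteq> U"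
      "\<And>q. q tagged_partial_division_of {a..b} \<Longrightarrow> (\<And>t K. (t, K) \<in> q \<Longrightarrow> K \<subseteq> U) \<Longrightarrow>
         (\<Sum>(t,K)\<in>q. norm (F (Sup K) - F (Inf K))) < e / 2"
      by (rule absolutely_continuous_sum_on_open[OF F N, of "e / 2"]) (use \<open>e > 0\<close> in simp, blast)
    have "\<exists>\<delta>>0. t \<in> {a..b} - N \<longrightarrow> (\<forall>y\<in>{a..b}. norm (y - t) < \<delta> \<longrightarrow>
            norm (F y - F t - (y - t) *\<^sub>R f t) \<le> c * norm (y - t))" for t
      using deriv[of t] \<open>c > 0\<close> zero_less_one
      unfolding has_vector_derivative_def has_derivative_within_alt by blast
    then obtain \<delta> where \<delta>: "\<And>t. \<delta> t > 0" "\<And>t y. \<lbrakk>t \<in> {a..b} - N; y \<in> {a..b}; norm (y - t) < \<delta> t\<rbrakk> \<Longrightarrow>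
            norm (F y - F t - (y - t) *\<^sub>R f t) \<le> c * norm (y - t)"
      by metis
    define \<gamma> where "\<gamma> t = (if t \<in> N then U else ball t (\<delta> t))" for t
    have "gauge \<gamma>" using U(1,2) \<delta>(1) by (auto simp: gauge_def \<gamma>_def)
    show "\<exists>\<gamma>. gauge \<gamma> \<and> (\<forall>q. q tagged_division_of {a..b} \<and> \<gamma> fine q \<longrightarrow>
             norm ((\<Sum>(t,K)\<in>q. measure lborel K *\<^sub>R ?f t) - (F b - F a)) < e)"
    proof (intro exI[of _ \<gamma>] conjI \<open>gauge \<gamma>\<close> allI impI, elim conjE)
      fix q assume q: "q tagged_division_of {a..b}" and fine: "\<gamma> fine q"
      have finq: "finite q" using q by blast
      define q1 where "q1 = {z \<in> q. fst z \<in> N}"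
      define q2 where "q2 = {z \<in> q. fst z \<notin> N}"
      have q12: "q = q1 \<union> q2" "q1 \<inter> q2 = {}" "finite q1" "finite q2"
        using finq by (auto simp: q1_def q2_def)
      let ?g = "\<lambda>(t,K). measure lborel K *\<^sub>R ?f t - (F (Sup K) - F (Inf K))"
      have bad: "norm (?g z) \<le> (\<lambda>(t,K). norm (F (Sup K) - F (Inf K))) z" if "z \<in> q1" for z
        using that by (cases z) (auto simp: q1_def norm_minus_commute)
      have good: "norm (?g z) \<le> (\<lambda>(t,K). c * (Sup K - Inf K)) z" if "z \<in> q2" for z
      proof -
        obtain t K where z: "z = (t, K)" by (cases z)
        have tK: "(t, K) \<in> q" "t \<notin> N" using that by (auto simp: z q2_def)
        obtain u v where K: "K = cbox u v" using tagged_division_ofD(4)[OF q tK(1)] by blast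
        have t: "t \<in> K" and Kab: "K \<subseteq> {a..b}" using tagged_division_ofD(2,3)[OF q tK(1)] by auto
        then have uv: "u \<le> t" "t \<le> v" "u \<in> {a..b}" "v \<in> {a..b}" "t \<in> {a..b} - N"
          using tK(2) by (auto simp: K)
        have "K \<subseteq> ball t (\<delta> t)" using fineD[OF fine tK(1)] tK(2) by (simp add: \<gamma>_def)
        then have near: "norm (u - t) < \<delta> t" "norm (v - t) < \<delta> t"
          using uv subsetD[OF _ t, of "ball t (\<delta> t)"] subsetD[of K "ball t (\<delta> t)" u] subsetD[of K "ball t (\<delta> t)" v]
          by (auto simp: K dist_real_def)
        \<comment> \<open>Both endpoints are compared with the tag. Since
          \<open>u \<le> t \<le> v\<close>, the two distances add up to exactly the length of the
          interval.\<close>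
        have "norm ((v - u) *\<^sub>R f t - (F v - F u)) =
            norm (F u - F t - (u - t) *\<^sub>R f t - (F v - F t - (v - t) *\<^sub>R f t))"
          by (simp add: algebra_simps)
        also have "\<dots> \<le> norm (F u - F t - (u - t) *\<^sub>R f t) + norm (F v - F t - (v - t) *\<^sub>R f t)"
          by (rule norm_triangle_ineq4)
        also have "\<dots> \<le> c * norm (u - t) + c * norm (v - t)"
          using \<delta>(2)[OF uv(5,3) near(1)] \<delta>(2)[OF uv(5,4) near(2)] by (rule add_mono)
        also have "\<dots> = c * (v - u)" using uv by (simp add: algebra_simps)
        finally show ?thesis using uv tK(2) by (simp add: z K)
      qed
      have "norm ((\<Sum>(t,K)\<in>q. measure lborel K *\<^sub>R ?f t) - (F b - F a)) = norm (\<Sum>z\<in>q. ?g z)"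
        unfolding additive_tagged_division_1[OF \<open>a \<le> b\<close> q, of F, symmetric] sum_subtractf[symmetric]
        by (simp add: split_def)
      also have "\<dots> = norm ((\<Sum>z\<in>q1. ?g z) + (\<Sum>z\<in>q2. ?g z))"
        using q12 sum.union_disjoint[of q1 q2 ?g] by simp
      also have "\<dots> \<le> norm (\<Sum>z\<in>q1. ?g z) + norm (\<Sum>z\<in>q2. ?g z)"
        by (rule norm_triangle_ineq)
      also have "\<dots> \<le> (\<Sum>(t,K)\<in>q1. norm (F (Sup K) - F (Inf K))) + (\<Sum>(t,K)\<in>q2. c * (Sup K - Inf K))"
        by (intro add_mono sum_norm_le bad good)
      also have "(\<Sum>(t,K)\<in>q2. c * (Sup K - Inf K)) \<le> (\<Sum>(t,K)\<in>q. c * (Sup K - Inf K))"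
      proof (rule sum_mono2[OF finq])
        fix z assume "z \<in> q - q2"
        then obtain t K where z: "z = (t, K)" "(t, K) \<in> q" by (cases z) auto
        obtain u v where K: "K = cbox u v" using tagged_division_ofD(4)[OF q z(2)] by blast
        have "u \<le> v" using tagged_division_ofD(2)[OF q z(2)] by (auto simp: K)
        then show "0 \<le> (case z of (t, K) \<Rightarrow> c * (Sup K - Inf K))"
          using \<open>c > 0\<close> by (simp add: z K)
      qed (simp add: q12)
      also have "(\<Sum>(t,K)\<in>q. c * (Sup K - Inf K)) = c * (b - a)"
        unfolding additive_tagged_division_1[OF \<open>a \<le> b\<close> q, of "\<lambda>t. t", symmetric]
        by (simp add: sum_distrib_left split_def)
      also have "(\<Sum>(t,K)\<in>q1. norm (F (Sup K) - F (Inf K))) < e / 2"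
      proof (rule U(3))
        show "q1 tagged_partial_division_of {a..b}"
          using q tagged_partial_division_subset[of q "{a..b}" q1]
          by (auto simp: tagged_division_of_def q12(1))
        fix t K assume "(t, K) \<in> q1"
        then have "(t, K) \<in> q" "t \<in> N" by (auto simp: q1_def)
        then show "K \<subseteq> U" using fineD[OF fine, of t K] by (simp add: \<gamma>_def)
      qed
      finally show "norm ((\<Sum>(t,K)\<in>q. measure lborel K *\<^sub>R ?f t) - (F b - F a)) < e"
        using c_bound by simp
    qed
  qed
qed

subsection \<open>Piecewise continuity and persistent excitation\<close>

lemma piecewise_continuous_one_sided_limits:
  assumes "piecewise_continuous u" "t \<ge> 0"
  shows "\<exists>l. (u \<longlongrightarrow> l) (at_right t)" "t > 0 \<Longrightarrow> \<exists>l. (u \<longlongrightarrow> l) (at_left t)"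
proof -
  obtain S where S: "\<And>s. s \<in> {0..t + 1} - S \<Longrightarrow> continuous (at s within {0..}) u"
    "\<And>s. s \<in> S \<Longrightarrow> (\<exists>l. (u \<longlongrightarrow> l) (at_right s)) \<and> (s > 0 \<longrightarrow> (\<exists>l. (u \<longlongrightarrow> l) (at_left s)))"
    using assms unfolding piecewise_continuous_def by (metis add_nonneg_pos zero_less_one)
  show "\<exists>l. (u \<longlongrightarrow> l) (at_right t)"
  proof (cases "t \<in> S")
    case False
    then have "(u \<longlongrightarrow> u t) (at t within {0..})"
      using S(1)[of t] assms(2) by (simp add: continuous_within)
    then have "(u \<longlongrightarrow> u t) (at_right t)"
      by (rule tendsto_within_subset) (use assms(2) in auto)
    then show ?thesis ..
  qed (use S(2) in blast)
  show "\<exists>l. (u \<longlongrightarrow> l) (at_left t)" if "t > 0"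
  proof (cases "t \<in> S")
    case False
    then have "(u \<longlongrightarrow> u t) (at t within {0..})"
      using S(1)[of t] assms(2) by (simp add: continuous_within)
    moreover have "at t within {0..} = at t"
      using that by (intro at_within_interior) (simp add: interior_Ici[of "-1"])
    ultimately have "(u \<longlongrightarrow> u t) (at_left t)"
      by (simp add: filterlim_at_split)
    then show ?thesis ..
  qed (use S(2) that in blast)
qed

text \<open>The one-sided limits and the value at the point bound \<open>u\<close> near every point
  of the interval; bisection makes the bound global.\<close>

lemma piecewise_continuous_imp_bounded:
  fixes u :: "real \<Rightarrow> 'a::real_normed_vector"
  assumes "piecewise_continuous u"
  shows "bounded (u ` {0..b})"
proof (cases "b \<ge> 0")
  case True
  have "bounded (u ` ({0..b} \<inter> {0..b}))"
    using True
  \<comment> \<open>The local clause ranges over intervals that may stick out of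
    \<open>{0..b}\<close>, where \<open>u\<close> is not controlled; hence the intersection.\<close>
  proof (induction rule: Bolzano[where P = "\<lambda>c d. bounded (u ` ({c..d} \<inter> {0..b}))"])
    case (trans c d e)
    then have "bounded (u ` (({c..d} \<inter> {0..b}) \<union> ({d..e} \<inter> {0..b})))"
      by (simp add: image_Un)
    then show ?case by (rule bounded_subset) auto
  next
    case (local t)
    obtain l where "(u \<longlongrightarrow> l) (at_right t)"
      using piecewise_continuous_one_sided_limits(1)[OF assms] local by blast
    then have "eventually (\<lambda>s. norm (u s) < norm l + 1) (at_right t)"
      by (intro order_tendstoD(2)[OF tendsto_norm]) auto
    then obtain d1 where d1: "d1 > t" "\<And>s. t < s \<Longrightarrow> s < d1 \<Longrightarrow> norm (u s) < norm l + 1"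
      unfolding eventually_at_right_field by blast
    have "\<exists>d2 M. d2 < t \<and> (\<forall>s. d2 < s \<and> s < t \<and> 0 \<le> s \<longrightarrow> norm (u s) \<le> M)"
    proof (cases "t > 0")
      case True
      obtain l where "(u \<longlongrightarrow> l) (at_left t)"
        using piecewise_continuous_one_sided_limits(2)[OF assms _ True] True by auto
      then have "eventually (\<lambda>s. norm (u s) < norm l + 1) (at_left t)"
        by (intro order_tendstoD(2)[OF tendsto_norm]) auto
      then show ?thesis unfolding eventually_at_left_field by (meson less_imp_le)
    next
      case False
      then show ?thesis using local by (intro exI[of _ "t - 1"]) auto
    qed
    then obtain d2 M where d2: "d2 < t" "\<And>s. d2 < s \<Longrightarrow> s < t \<Longrightarrow> 0 \<le> s \<Longrightarrow> norm (u s) \<le> M"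
      by blast
    show ?case
    proof (intro exI[of _ "min (d1 - t) (t - d2)"] conjI allI impI)
      fix c d assume cd: "c \<le> t \<and> t \<le> d \<and> d - c < min (d1 - t) (t - d2)"
      have "norm (u s) \<le> max (norm (u t)) (max (norm l + 1) M)" if "s \<in> {c..d} \<inter> {0..b}" for s
        using that cd d1(2)[of s] d2(2)[of s] by (cases s t rule: linorder_cases) auto
      then show "bounded (u ` ({c..d} \<inter> {0..b}))" unfolding bounded_iff by blast
    qed (use d1 d2 in auto)
  qed
  then show ?thesis by simp
qed simp

text \<open>Off a finite set the composition is continuous, hence measurable. It is bounded because
  the closure of the range of \<open>u\<close> is compact and \<open>g\<close> is continuous there.
  The finite set is negligible.\<close>

lemma piecewise_continuous_compose_integrable:
  fixes u :: "real \<Rightarrow> 'a::euclidean_space" and g :: "'a \<Rightarrow> 'b::euclidean_space"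
  assumes u: "piecewise_continuous u" and g: "continuous_on UNIV g" and "0 \<le> a"
  shows "(\<lambda>s. g (u s)) integrable_on {a..b}"
proof -
  \<comment> \<open>Piecewise continuity speaks of positive right endpoints only, and
    \<open>b\<close> is arbitrary.\<close>
  have mb: "max b 1 > 0" by simp
  obtain S where S: "finite S" "\<And>t. t \<in> {0..max b 1} - S \<Longrightarrow> continuous (at t within {0..}) u"
    using u[unfolded piecewise_continuous_def, rule_format, OF mb] by blast
  have "bounded (g ` closure (u ` {0..b}))"
    using piecewise_continuous_imp_bounded[OF u] g
    by (intro compact_imp_bounded compact_continuous_image) (auto intro: continuous_on_subset simp: compact_closure)
  then obtain M where M_image: "\<forall>z\<in>g ` closure (u ` {0..b}). norm z \<le> M"
    unfolding bounded_iff ..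
  have M: "norm (g y) \<le> M" if "y \<in> closure (u ` {0..b})" for y
    by (rule bspec[OF M_image imageI[OF that]])
  have gu: "norm (g (u s)) \<le> M" if "s \<in> {a..b} - S" for s
  proof (rule M)
    have "u s \<in> u ` {0..b}" using that \<open>0 \<le> a\<close> by auto
    then show "u s \<in> closure (u ` {0..b})" by (rule subsetD[OF closure_subset])
  qed
  have meas: "{a..b} - S \<in> lmeasurable"
    by (rule fmeasurable.Diff[OF _ negligible_imp_measurable[OF negligible_finite[OF S(1)]]]) simp
  have "continuous_on ({a..b} - S) u"
    unfolding continuous_on_eq_continuous_within
  proof
    fix t assume "t \<in> {a..b} - S"
    then have "continuous (at t within {0..}) u" using S(2)[of t] \<open>0 \<le> a\<close> by (auto simp: le_max_iff_disj)
    then show "continuous (at t within {a..b} - S) u"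
      by (rule continuous_within_subset) (use \<open>0 \<le> a\<close> in auto)
  qed
  then have "continuous_on ({a..b} - S) (\<lambda>s. g (u s))"
    by (rule continuous_on_compose2[OF g]) auto
  then have "(\<lambda>s. g (u s)) \<in> borel_measurable (lebesgue_on ({a..b} - S))"
    by (rule continuous_imp_measurable_on_sets_lebesgue[OF _ fmeasurableD[OF meas]])
  then have "(\<lambda>s. g (u s)) integrable_on ({a..b} - S)"
    by (rule measurable_bounded_by_integrable_imp_integrable[OF _ integrable_on_const[OF meas] gu fmeasurableD[OF meas]])
  then show ?thesis
    by (rule integrable_spike_set) (auto intro: negligible_subset[OF negligible_finite[OF S(1)]])
qed

section \<open>Lower bounds for integrals of powers of the excitation\<close>

lemma continuous_on_abs_powr:
  fixes q :: real
  assumes "q > 0"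
  shows "continuous_on A (\<lambda>v::real. \<bar>v\<bar> powr q)"
  using assms by (intro continuous_on_powr' continuous_intros) auto

text \<open>A convex function lies above its tangent at \<open>c\<close>. Convexity is applied on
  the open half-line, so \<open>y = 0\<close> is computed directly: there the left side equals
  \<open>(1 - q) * c powr q\<close>.\<close>

lemma powr_tangent_le:
  fixes y c q :: real
  assumes "y \<ge> 0" "c > 0" "q \<ge> 1"
  shows "c powr q + q * c powr (q - 1) * (y - c) \<le> y powr q"
proof (cases "y = 0")
  case True
  have "c powr (q - 1) * c = c powr q"
    using assms(2) by (simp add: powr_diff)
  then have "c powr q + q * c powr (q - 1) * (y - c) = (1 - q) * c powr q"
    using True by (simp add: algebra_simps)
  also have "\<dots> \<le> 0" using assms(3) by (simp add: mult_nonpos_nonneg)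
  finally show ?thesis by (simp add: True)
next
  case False
  have "y powr q - c powr q \<ge> q * c powr (q - 1) * (y - c)"
  proof (rule convex_on_imp_above_tangent[OF powr_convex[OF assms(3)]])
    show "((\<lambda>x. x powr q) has_real_derivative q * c powr (q - 1)) (at c within {0<..})"
      using assms(2) by (auto intro!: has_field_derivative_at_within has_real_derivative_powr)
  qed (use assms False in \<open>auto simp: interior_open\<close>)
  then show ?thesis by simp
qed

lemma persistent_excitation_powr_integral:
  fixes u :: "real \<Rightarrow> real"
  assumes pe: "persistently_exciting_with u T \<epsilon>" and "q \<ge> 1" and "t \<ge> 0"
  shows "integral {t..t + T} (\<lambda>s. \<bar>u s\<bar> powr q) \<ge> T * \<epsilon> powr q"
proof -
  from pe have pc: "piecewise_continuous u" and "T > 0" "\<epsilon> > 0"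
    unfolding persistently_exciting_with_def by auto
  have avg: "(1 / T) * integral {t..t + T} (\<lambda>s. \<bar>u s \<bullet> 1\<bar>) \<ge> \<epsilon>"
    using pe \<open>t \<ge> 0\<close> unfolding persistently_exciting_with_def by (metis norm_one)
  have int1: "(\<lambda>s. \<bar>u s\<bar>) integrable_on {t..t + T}"
    by (rule piecewise_continuous_compose_integrable[OF pc _ \<open>t \<ge> 0\<close>]) (intro continuous_intros)
  have intq: "(\<lambda>s. \<bar>u s\<bar> powr q) integrable_on {t..t + T}"
    using \<open>q \<ge> 1\<close>
    by (intro piecewise_continuous_compose_integrable[OF pc _ \<open>t \<ge> 0\<close>, of "\<lambda>v. \<bar>v\<bar> powr q"]
        continuous_on_abs_powr) simp
  let ?c = "q * \<epsilon> powr (q - 1)"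
  have "T * \<epsilon> \<le> integral {t..t + T} (\<lambda>s. \<bar>u s\<bar>)"
    using avg \<open>T > 0\<close> by (simp add: field_simps)
  then have "T * \<epsilon> powr q \<le> T * \<epsilon> powr q + ?c * (integral {t..t + T} (\<lambda>s. \<bar>u s\<bar>) - T * \<epsilon>)"
    using \<open>q \<ge> 1\<close> by simp
  also have "\<dots> \<le> integral {t..t + T} (\<lambda>s. \<bar>u s\<bar> powr q)"
  proof (rule has_integral_le[OF _ integrable_integral[OF intq]])
    have "((\<lambda>s. (\<epsilon> powr q - ?c * \<epsilon>) + ?c * \<bar>u s\<bar>) has_integral
        (measure lborel {t..t + T} *\<^sub>R (\<epsilon> powr q - ?c * \<epsilon>) + ?c * integral {t..t + T} (\<lambda>s. \<bar>u s\<bar>))) {t..t + T}"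
      by (intro has_integral_add has_integral_const_real has_integral_mult_right integrable_integral int1)
    then show "((\<lambda>s. (\<epsilon> powr q - ?c * \<epsilon>) + ?c * \<bar>u s\<bar>) has_integral
        (T * \<epsilon> powr q + ?c * (integral {t..t + T} (\<lambda>s. \<bar>u s\<bar>) - T * \<epsilon>))) {t..t + T}"
      using \<open>T > 0\<close> by (simp add: algebra_simps)
    show "(\<epsilon> powr q - ?c * \<epsilon>) + ?c * \<bar>u s\<bar> \<le> \<bar>u s\<bar> powr q" for s
      using powr_tangent_le[of "\<bar>u s\<bar>" \<epsilon> q] \<open>\<epsilon> > 0\<close> \<open>q \<ge> 1\<close> by (simp add: algebra_simps)
  qed
  finally show ?thesis .
qed

lemma persistent_excitation_powr_integral_periods:
  fixes u :: "real \<Rightarrow> real"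
  assumes pe: "persistently_exciting_with u T \<epsilon>" and "q \<ge> 1" and "t \<ge> 0"
  shows "integral {t..t + real n * T} (\<lambda>s. \<bar>u s\<bar> powr q) \<ge> real n * T * \<epsilon> powr q"
proof (induction n)
  case (Suc n)
  from pe have pc: "piecewise_continuous u" and "T > 0"
    unfolding persistently_exciting_with_def by auto
  let ?m = "t + real n * T"
  have eq: "t + real (Suc n) * T = ?m + T" by (simp add: algebra_simps)
  have le: "t \<le> ?m" "?m \<le> ?m + T" using \<open>T > 0\<close> by auto
  have "(\<lambda>s. \<bar>u s\<bar> powr q) integrable_on {t..?m + T}"
    using \<open>q \<ge> 1\<close>
    by (intro piecewise_continuous_compose_integrable[OF pc _ \<open>t \<ge> 0\<close>, of "\<lambda>v. \<bar>v\<bar> powr q"]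
        continuous_on_abs_powr) simp
  then have "integral {t..?m + T} (\<lambda>s. \<bar>u s\<bar> powr q) =
      integral {t..?m} (\<lambda>s. \<bar>u s\<bar> powr q) + integral {?m..?m + T} (\<lambda>s. \<bar>u s\<bar> powr q)"
    using Henstock_Kurzweil_Integration.integral_combine[OF le] by metis
  moreover have "integral {?m..?m + T} (\<lambda>s. \<bar>u s\<bar> powr q) \<ge> T * \<epsilon> powr q"
    using persistent_excitation_powr_integral[OF pe \<open>q \<ge> 1\<close>, of ?m] le \<open>t \<ge> 0\<close> by simp
  ultimately show ?case using Suc unfolding eq by (simp add: algebra_simps)
qed simp

subsection \<open>The scalar system\<close>

text \<open>The sign of \<open>a\<close> in the signed power and the outer factor \<open>a\<close>
  combine to \<open>\<bar>a\<bar>\<close>. This separates the variables: the factor depending on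
  time becomes nonnegative, whatever the sign of the excitation.\<close>

lemma signed_powr_mult_self:
  "signed_powr (a * x) p * a = \<bar>a\<bar> powr (p + 1) * \<bar>x\<bar> powr p * sgn x"
proof -
  have "signed_powr (a * x) p * a = \<bar>a\<bar> powr p * (sgn a * a) * \<bar>x\<bar> powr p * sgn x"
    by (simp add: signed_powr_def abs_mult sgn_mult powr_mult)
  also have "\<bar>a\<bar> powr p * (sgn a * a) = \<bar>a\<bar> powr (p + 1)"
    by (simp add: powr_add sgn_if)
  finally show ?thesis .
qed

abbreviation (input) powr_field :: "(real \<Rightarrow> real) \<Rightarrow> real \<Rightarrow> real \<Rightarrow> real \<Rightarrow> real" where
  "powr_field u p \<equiv> \<lambda>x t. - signed_powr (u t * x) p * u t"

text \<open>For \<open>r \<le> 1\<close> the derivative does not increase, so it is largest at the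
  left endpoint \<open>m\<close>. Near zero it may blow up, which is why
  \<open>\<bar>x\<bar> powr (1 - p)\<close> is studied on intervals where \<open>x\<close> has no
  zero.\<close>

lemma powr_lipschitz_on:
  fixes r m :: real
  assumes "0 \<le> r" "r \<le> 1" "0 < m"
  shows "(r * m powr (r - 1))-lipschitz_on {m..} (\<lambda>v. v powr r)"
proof (rule lipschitz_onI)
  fix v w assume vw: "v \<in> {m..}" "w \<in> {m..}"
  have "norm (v powr r - w powr r) \<le> (r * m powr (r - 1)) * norm (v - w)"
  proof (rule field_differentiable_bound[OF convex_real_interval(1)[of m]])
    show "v \<in> {m..}" "w \<in> {m..}" by (fact vw)+
    fix z :: real assume z: "z \<in> {m..}"
    have "z > 0" using z assms by simp
    then show "((\<lambda>v. v powr r) has_field_derivative r * z powr (r - 1)) (at z within {m..})"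
      by (rule has_field_derivative_at_within[OF has_real_derivative_powr])
    show "norm (r * z powr (r - 1)) \<le> r * m powr (r - 1)"
      using powr_mono2'[of "r - 1" m z] z assms by (simp add: abs_mult mult_left_mono)
  qed
  then show "dist (v powr r) (w powr r) \<le> r * m powr (r - 1) * dist v w"
    by (simp add: dist_norm)
qed (use assms in simp)

lemma is_solution_continuous_on: "is_solution f t0 x0 x \<Longrightarrow> continuous_on {t0..b} x"
  unfolding is_solution_def
  by (cases "t0 \<le> b") (auto intro: absolutely_continuous_on_imp_continuous_on)

section \<open>Decay and settling time of an arbitrary solution\<close>

text \<open>Without zeros on a compact interval, \<open>\<bar>x\<bar>\<close> stays above a positive
  minimum, so its power is absolutely continuous. The chain rule gives its derivative almost
  everywhere, and that derivative no longer involves \<open>x\<close>.\<close>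

lemma powr_field_abs_powr_decrease:
  assumes sol: "is_solution (powr_field u p) t0 x0 x"
    and p: "0 \<le> p" "p < 1" and ab: "t0 \<le> a" "a \<le> b"
    and nz: "\<And>t. t \<in> {a..b} \<Longrightarrow> x t \<noteq> 0"
  shows "((\<lambda>t. (1 - p) * \<bar>u t\<bar> powr (p + 1)) has_integral
            (\<bar>x a\<bar> powr (1 - p) - \<bar>x b\<bar> powr (1 - p))) {a..b}"
proof -
  have sub: "{a..b} \<subseteq> {t0..b}" "t0 \<le> b" using ab by auto
  have AC: "absolutely_continuous_on {a..b} x"
    using sol sub absolutely_continuous_on_subset unfolding is_solution_def by blast
  have "continuous_on {a..b} (\<lambda>t. \<bar>x t\<bar>)"
    using absolutely_continuous_on_imp_continuous_on[OF AC] by (rule continuous_on_rabs)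
  then obtain c where c: "c \<in> {a..b}" "\<And>t. t \<in> {a..b} \<Longrightarrow> \<bar>x c\<bar> \<le> \<bar>x t\<bar>"
    using continuous_attains_inf[of "{a..b}" "\<lambda>t. \<bar>x t\<bar>"] ab by auto
  have m: "\<bar>x c\<bar> > 0" using nz[OF c(1)] by simp
  have "absolutely_continuous_on {a..b} (\<lambda>t. \<bar>x t\<bar>)"
    by (rule absolutely_continuous_on_compose_lipschitz[OF AC, of 1])
      (auto intro!: lipschitz_onI simp: dist_real_def)
  then have ACW: "absolutely_continuous_on {a..b} (\<lambda>t. \<bar>x t\<bar> powr (1 - p))"
    by (rule absolutely_continuous_on_compose_lipschitz[OF _ lipschitz_on_subset[OF powr_lipschitz_on[OF _ _ m]]])
      (use p c(2) m in auto)
  have "AE t in lebesgue. t \<ge> t0 \<longrightarrow> (x has_vector_derivative powr_field u p (x t) t) (at t within {t0..})"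
    using sol unfolding is_solution_def by (elim conjE)
  then obtain N where N: "negligible N"
    "{t. \<not> (t \<ge> t0 \<longrightarrow> (x has_vector_derivative powr_field u p (x t) t) (at t within {t0..}))} \<subseteq> N"
    unfolding eventually_ae_filter_negligible by (elim exE conjE)
  have "((\<lambda>t. - ((1 - p) * \<bar>u t\<bar> powr (p + 1))) has_integral
            (\<bar>x b\<bar> powr (1 - p) - \<bar>x a\<bar> powr (1 - p))) {a..b}"
  proof (rule fundamental_theorem_of_calculus_absolutely_continuous[OF ab(2) ACW N(1)])
    fix t assume t: "t \<in> {a..b} - N"
    let ?D = "powr_field u p (x t) t"
    have xt: "x t \<noteq> 0" using t nz by auto
    have "(x has_vector_derivative ?D) (at t within {t0..})"
      using subsetD[OF N(2), of t] t ab by fastforce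
    then have dx: "(x has_real_derivative ?D) (at t within {a..b})"
      unfolding has_real_derivative_iff_has_vector_derivative
      by (rule has_vector_derivative_within_subset) (use ab in auto)
    \<comment> \<open>The general derivative of the norm is phrased with an inner product; on the
      reals it is multiplication by the sign.\<close>
    have "(norm :: real \<Rightarrow> real) = abs" "(\<lambda>h. h \<bullet> sgn (x t)) = (*) (sgn (x t))" by (rule ext, simp)+
    then have "(abs has_real_derivative sgn (x t)) (at (x t))"
      using has_derivative_norm[OF xt] by (simp only: has_field_derivative_def)
    then have dabs: "((\<lambda>t. \<bar>x t\<bar>) has_real_derivative sgn (x t) * ?D) (at t within {a..b})"
      by (rule DERIV_chain2[OF _ dx])
    have "((\<lambda>v. v powr (1 - p)) has_real_derivative (1 - p) * \<bar>x t\<bar> powr (1 - p - 1)) (at \<bar>x t\<bar>)"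
      using xt by (intro has_real_derivative_powr) auto
    from DERIV_chain2[OF this dabs]
    have "((\<lambda>t. \<bar>x t\<bar> powr (1 - p)) has_real_derivative
        (1 - p) * \<bar>x t\<bar> powr (1 - p - 1) * (sgn (x t) * ?D)) (at t within {a..b})" .
    \<comment> \<open>The exponent \<open>1 - p - 1 = - p\<close> from the chain rule cancels the
      power \<open>p\<close> of the right-hand side, and the two signs of \<open>x t\<close>
      multiply to one.\<close>
    also have "(1 - p) * \<bar>x t\<bar> powr (1 - p - 1) * (sgn (x t) * ?D)
        = - ((1 - p) * \<bar>u t\<bar> powr (p + 1)) * (\<bar>x t\<bar> powr (- p) * \<bar>x t\<bar> powr p) * (sgn (x t) * sgn (x t))"
      by (simp add: signed_powr_mult_self)
    also have "\<bar>x t\<bar> powr (- p) * \<bar>x t\<bar> powr p = 1"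
      using xt by (simp add: powr_add[symmetric])
    also have "sgn (x t) * sgn (x t) = 1" using xt by (simp add: sgn_if)
    finally show "((\<lambda>t. \<bar>x t\<bar> powr (1 - p)) has_vector_derivative - ((1 - p) * \<bar>u t\<bar> powr (p + 1)))
        (at t within {a..b})"
      by (simp add: has_real_derivative_iff_has_vector_derivative)
  qed
  from has_integral_neg[OF this] show ?thesis by simp
qed

lemma powr_field_abs_decrease:
  assumes sol: "is_solution (powr_field u p) t0 x0 x"
    and p: "0 \<le> p" "p < 1" and ab: "t0 \<le> a" "a \<le> b"
    and nz: "\<And>t. t \<in> {a..b} \<Longrightarrow> x t \<noteq> 0"
  shows "\<bar>x b\<bar> \<le> \<bar>x a\<bar>"
proof -
  have "0 \<le> \<bar>x a\<bar> powr (1 - p) - \<bar>x b\<bar> powr (1 - p)"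
    by (rule has_integral_nonneg[OF powr_field_abs_powr_decrease[OF assms]]) (use p in auto)
  then show ?thesis
    using powr_less_mono2[of "1 - p" "\<bar>x a\<bar>" "\<bar>x b\<bar>"] p by (cases "\<bar>x b\<bar> \<le> \<bar>x a\<bar>") auto
qed

text \<open>If \<open>x d\<close> were nonzero, consider the last zero \<open>z\<close> before
  \<open>d\<close>. After \<open>z\<close> the absolute value cannot grow, yet by continuity it is
  smaller than \<open>\<bar>x d\<bar>\<close> just after \<open>z\<close>. The argument applies to
  every solution and needs no uniqueness theorem.\<close>

lemma powr_field_zero_absorbing:
  assumes sol: "is_solution (powr_field u p) t0 x0 x"
    and p: "0 \<le> p" "p < 1" and cd: "t0 \<le> c" "c \<le> d" and "x c = 0"
  shows "x d = 0"
proof (rule ccontr)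
  assume nz: "x d \<noteq> 0"
  have cont: "continuous_on {c..d} x"
    using is_solution_continuous_on[OF sol, of d] by (rule continuous_on_subset) (use cd in auto)
  \<comment> \<open>Compactness of the zero set provides its largest element.\<close>
  have "compact {t \<in> {c..d}. x t = 0}"
    using continuous_closed_preimage[OF cont, of "{0}"]
    by (auto simp: compact_eq_bounded_closed vimage_def Int_def intro: bounded_subset[OF bounded_closed_interval])
  moreover have "{t \<in> {c..d}. x t = 0} \<noteq> {}" using \<open>x c = 0\<close> cd by auto
  ultimately obtain z where z: "z \<in> {c..d}" "x z = 0" "\<And>t. t \<in> {c..d} \<Longrightarrow> x t = 0 \<Longrightarrow> t \<le> z"
    using compact_attains_sup[of "{t \<in> {c..d}. x t = 0}"] by auto
  then have "z < d" using nz by (cases "z = d") auto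
  obtain \<delta> where \<delta>: "\<delta> > 0" "\<And>t. t \<in> {c..d} \<Longrightarrow> dist t z < \<delta> \<Longrightarrow> dist (x t) (x z) < \<bar>x d\<bar>"
    using cont z(1) nz unfolding continuous_on_iff by (metis zero_less_abs_iff)
  \<comment> \<open>A point strictly after the last zero, within the continuity radius and not
    beyond \<open>d\<close>.\<close>
  define a where "a = min d (z + \<delta> / 2)"
  have a: "z < a" "a \<le> d" "a \<in> {c..d}" "dist a z < \<delta>"
    using \<delta>(1) \<open>z < d\<close> z(1) by (auto simp: a_def dist_real_def min_def)
  have "\<bar>x d\<bar> \<le> \<bar>x a\<bar>"
  proof (rule powr_field_abs_decrease[OF sol p _ a(2)])
    show "t0 \<le> a" using a cd by auto
    show "x t \<noteq> 0" if "t \<in> {a..d}" for t using z(3)[of t] that a by force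
  qed
  then show False using \<delta>(2)[OF a(3,4)] z(2) by simp
qed

text \<open>If \<open>x t\<close> is nonzero, absorption excludes all earlier zeros, so the decrease
  holds on the whole interval. This yields uniform stability.\<close>

lemma powr_field_abs_le_initial:
  assumes sol: "is_solution (powr_field u p) t0 x0 x" and p: "0 \<le> p" "p < 1" and "t0 \<le> t"
  shows "\<bar>x t\<bar> \<le> \<bar>x t0\<bar>"
proof (cases "x t = 0")
  case False
  then have "x s \<noteq> 0" if "s \<in> {t0..t}" for s
    using powr_field_zero_absorbing[OF sol p, of s t] that by auto
  then show ?thesis by (rule powr_field_abs_decrease[OF sol p order.refl \<open>t0 \<le> t\<close>])
qed simp

text \<open>If \<open>x t\<close> were nonzero, absorption would exclude zeros throughout the first
  \<open>n\<close> periods. Over these the power \<open>\<bar>x\<bar> powr (1 - p)\<close> loses at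
  least \<open>n * ?C\<close>, which is no less than its initial value \<open>?W\<close>, although
  it must remain positive.\<close>

lemma powr_field_settling_time:
  assumes pe: "persistently_exciting_with u T \<epsilon>"
    and sol: "is_solution (powr_field u p) t0 x0 x" and p: "0 \<le> p" "p < 1" and "0 \<le> t0"
    and t: "t \<ge> t0 + of_int \<lceil>\<bar>x t0\<bar> powr (1 - p) / ((1 - p) * T * \<epsilon> powr (p + 1))\<rceil> * T"
  shows "x t = 0"
proof (rule ccontr)
  assume nz: "x t \<noteq> 0"
  let ?C = "(1 - p) * T * \<epsilon> powr (p + 1)"
  let ?W = "\<bar>x t0\<bar> powr (1 - p)"
  define n where "n = nat \<lceil>?W / ?C\<rceil>"
  have T: "T > 0" "\<epsilon> > 0" using pe by (auto simp: persistently_exciting_with_def)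
  have C: "?C > 0" using T p by simp
  then have "?W / ?C \<ge> 0" by simp
  \<comment> \<open>The quotient is nonnegative, so \<open>nat\<close> does not change the
    ceiling.\<close>
  then have n: "real n = of_int \<lceil>?W / ?C\<rceil>" by (simp add: n_def)
  have "?W / ?C \<le> real n" unfolding n by simp
  then have Wn: "?W \<le> real n * ?C" using C by (simp add: pos_divide_le_eq)
  let ?b = "t0 + real n * T"
  have b: "t0 \<le> ?b" "?b \<le> t" using T t by (simp_all add: n[symmetric])
  have nzb: "x s \<noteq> 0" if "s \<in> {t0..?b}" for s
    using powr_field_zero_absorbing[OF sol p, of s t] that b nz by auto
  have "integral {t0..?b} (\<lambda>t. (1 - p) * \<bar>u t\<bar> powr (p + 1)) = ?W - \<bar>x ?b\<bar> powr (1 - p)"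
    by (rule integral_unique[OF powr_field_abs_powr_decrease[OF sol p order.refl b(1) nzb]])
  moreover have "integral {t0..?b} (\<lambda>t. (1 - p) * \<bar>u t\<bar> powr (p + 1)) =
      (1 - p) * integral {t0..?b} (\<lambda>t. \<bar>u t\<bar> powr (p + 1))"
    by (rule integral_mult_right)
  moreover have "(1 - p) * integral {t0..?b} (\<lambda>t. \<bar>u t\<bar> powr (p + 1)) \<ge> (1 - p) * (real n * T * \<epsilon> powr (p + 1))"
    using persistent_excitation_powr_integral_periods[OF pe _ \<open>0 \<le> t0\<close>, of "p + 1" n] p
    by (intro mult_left_mono) auto
  moreover have "\<bar>x ?b\<bar> powr (1 - p) > 0" using nzb[of ?b] b by simp
  moreover have "real n * ?C = (1 - p) * (real n * T * \<epsilon> powr (p + 1))"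
    by (simp only: mult_ac)
  ultimately show False using Wn by linarith
qed

section \<open>Existence of solutions\<close>

text \<open>Each interval \<open>{0..n + 1}\<close> contains finitely many discontinuities, and
  countably many such intervals cover the half-line.\<close>

lemma piecewise_continuous_negligible_discontinuities:
  assumes "piecewise_continuous u"
  shows "negligible {t. 0 \<le> t \<and> \<not> continuous (at t within {0..}) u}"
proof -
  have "\<exists>S. finite S \<and> (\<forall>t\<in>{0..real (Suc n)} - S. continuous (at t within {0..}) u)" for n
    using assms[unfolded piecewise_continuous_def, rule_format, of "real (Suc n)"] by (simp only: of_nat_0_less_iff zero_less_Suc) blast
  then obtain S where S: "\<And>n. finite (S n)"
    "\<And>n t. t \<in> {0..real (Suc n)} - S n \<Longrightarrow> continuous (at t within {0..}) u"
    by metis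
  have "negligible (\<Union>(range S))"
    using S(1) by (intro negligible_countable_Union) (auto intro: negligible_finite)
  then show ?thesis
  proof (rule negligible_subset, safe)
    fix t assume t: "0 \<le> t" "\<not> continuous (at t within {0..}) u"
    obtain n where "t \<le> real n" using real_arch_simple by blast
    then have "t \<in> {0..real (Suc n)}" using t(1) by simp
    then have "t \<in> S n" using S(2)[of t n] t(2) by blast
    then show "t \<in> \<Union>(range S)" by blast
  qed
qed

lemma lipschitz_on_integral:
  fixes h :: "real \<Rightarrow> real"
  assumes int: "h integrable_on {a..b}" and M: "\<And>s. s \<in> {a..b} \<Longrightarrow> \<bar>h s\<bar> \<le> M" "0 \<le> M"
  shows "M-lipschitz_on {a..b} (\<lambda>t. integral {a..t} h)"
proof (rule lipschitz_on_leI)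
  fix v w assume vw: "v \<in> {a..b}" "w \<in> {a..b}" "v \<le> w"
  have int_aw: "h integrable_on {a..w}" and int_vw: "h integrable_on {v..w}"
    by (rule integrable_subinterval_real[OF int]; use vw in auto)+
  have "integral {a..v} h + integral {v..w} h = integral {a..w} h"
    by (rule Henstock_Kurzweil_Integration.integral_combine[OF _ vw(3) int_aw]) (use vw in auto)
  moreover have "norm (integral {v..w} h) \<le> M * measure lborel {v..w}"
    by (rule has_integral_bound_real[OF M(2) finite.emptyI integrable_integral[OF int_vw]])
      (use M(1) vw in auto)
  ultimately show "dist (integral {a..v} h) (integral {a..w} h) \<le> M * dist v w"
    using vw by (auto simp: dist_real_def)
qed (fact M(2))

text \<open>Taking the positive part does not increase distances, and for \<open>q \<ge> 1\<close>
  the slope of the power is largest at \<open>c\<close>. The increment is bounded by the tangent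
  inequality at the larger point, which must be positive for that; hence the case
  \<open>w' = 0\<close>.\<close>

lemma positive_part_powr_lipschitz_on:
  fixes q c :: real
  assumes "q \<ge> 1" "c \<ge> 0"
  shows "(q * c powr (q - 1))-lipschitz_on {..c} (\<lambda>v. max 0 v powr q)"
proof (rule lipschitz_on_leI)
  fix v w :: real assume vw: "v \<in> {..c}" "w \<in> {..c}" "v \<le> w"
  define v' where "v' = max 0 v"
  define w' where "w' = max 0 w"
  have le: "0 \<le> v'" "v' \<le> w'" "w' \<le> c" "w' - v' \<le> w - v"
    using vw assms by (auto simp: v'_def w'_def max_def)
  have mono: "v' powr q \<le> w' powr q" using le assms by (intro powr_mono2) auto
  have "w' powr q - v' powr q \<le> q * c powr (q - 1) * (w - v)"
  proof (cases "w' = 0")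
    case True
    then show ?thesis using le assms vw by simp
  next
    case False
    then have "w' powr q - v' powr q \<le> q * w' powr (q - 1) * (w' - v')"
      using powr_tangent_le[of v' w' q] le assms by (simp add: algebra_simps)
    also have "\<dots> \<le> q * c powr (q - 1) * (w - v)"
      using le assms powr_mono2[of "q - 1" w' c] by (intro mult_mono) auto
    finally show ?thesis .
  qed
  then show "dist (max 0 v powr q) (max 0 w powr q) \<le> q * c powr (q - 1) * dist v w"
    using mono vw(3) unfolding v'_def w'_def by (simp add: dist_real_def)
qed (use assms in simp)

text \<open>The explicit solution is the \<open>1 / (1 - p)\<close>-th power of the positive part of an
  antiderivative. For \<open>p = 0\<close> it need not be differentiable where it reaches zero, so the
  frontier of its zero set joins the exceptional null set.\<close>

lemma powr_field_solution_exists: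
  fixes u :: "real \<Rightarrow> real"
  assumes pc: "piecewise_continuous u" and "0 \<le> t0" and p: "0 \<le> p" "p < 1"
  shows "\<exists>x. is_solution (powr_field u p) t0 x0 x"
proof -
  define h where "h t = \<bar>u t\<bar> powr (p + 1)" for t
  define c where "c = \<bar>x0\<bar> powr (1 - p)"
  define q where "q = 1 / (1 - p)"
  \<comment> \<open>This is the value that the separated equation forces on
    \<open>\<bar>x\<bar> powr (1 - p)\<close>. It may become negative, so the solution uses its
    positive part.\<close>
  define s where "s t = c - (1 - p) * integral {t0..t} h" for t
  define x where "x t = sgn x0 * max 0 (s t) powr q" for t
  define Z where "Z = {t. t0 \<le> t \<and> s t \<le> 0}"
  have q: "q \<ge> 1" "(1 - p) * q = 1" "q * p = q - 1" using p by (auto simp: q_def field_simps)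
  have c: "c \<ge> 0" by (simp add: c_def)
  have h_cont: "continuous_on UNIV (\<lambda>v::real. \<bar>v\<bar> powr (p + 1))"
    using p by (intro continuous_on_abs_powr) simp
  have h_nonneg: "h t \<ge> 0" for t by (simp add: h_def)
  have int: "h integrable_on {a..b}" if "0 \<le> a" for a b
    unfolding h_def by (rule piecewise_continuous_compose_integrable[OF pc h_cont that])
  have s_le: "s w \<le> s v" if "t0 \<le> v" "v \<le> w" for v w
  proof -
    have "integral {t0..v} h \<le> integral {t0..w} h"
      using that \<open>0 \<le> t0\<close> by (intro integral_subset_le int) (auto simp: h_nonneg)
    then show ?thesis using p by (simp add: s_def mult_left_mono)
  qed
  have s_t0: "s t0 = c" by (simp add: s_def)
  have x_t0: "x t0 = x0"
  proof -
    have "max 0 (s t0) powr q = \<bar>x0\<bar>"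
      using c q by (simp add: s_t0 max_def) (simp add: c_def powr_powr)
    then show ?thesis by (simp add: x_def mult_sgn_abs)
  qed
  have AC: "absolutely_continuous_on {t0..b} x" for b
  proof -
    have "bounded (u ` {0..b})" by (rule piecewise_continuous_imp_bounded[OF pc])
    then obtain B where B: "\<forall>y\<in>u ` {0..b}. norm y \<le> B" unfolding bounded_iff ..
    have hB: "\<bar>h t\<bar> \<le> B powr (p + 1)" if "t \<in> {t0..b}" for t
    proof -
      have "\<bar>u t\<bar> \<le> B" using B that \<open>0 \<le> t0\<close> by auto
      then show ?thesis using p by (simp add: h_def powr_mono2)
    qed
    have "(B powr (p + 1))-lipschitz_on {t0..b} (\<lambda>t. integral {t0..t} h)"
      by (rule lipschitz_on_integral[OF int[OF \<open>0 \<le> t0\<close>] hB powr_ge_zero])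
    from lipschitz_on_cmult_real[OF this, of "1 - p"]
    have "((1 - p) * B powr (p + 1))-lipschitz_on {t0..b} (\<lambda>t. (1 - p) * integral {t0..t} h)"
      using p by simp
    then have "(0 + (1 - p) * B powr (p + 1))-lipschitz_on {t0..b} s"
      unfolding s_def[abs_def] by (intro lipschitz_on_diff lipschitz_on_constant)
    then have "absolutely_continuous_on {t0..b} s"
      by (rule lipschitz_imp_absolutely_continuous_on)
    then have "absolutely_continuous_on {t0..b} (\<lambda>t. max 0 (s t) powr q)"
    proof (rule absolutely_continuous_on_compose_lipschitz)
      \<comment> \<open>Since \<open>s\<close> does not increase, its values on the interval are at
        most \<open>s t0 = c\<close>.\<close>
      show "(q * c powr (q - 1))-lipschitz_on (s ` {t0..b}) (\<lambda>v. max 0 v powr q)"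
        by (rule lipschitz_on_subset[OF positive_part_powr_lipschitz_on[OF q(1) c]])
          (use s_le[of t0] s_t0 in auto)
    qed
    then show ?thesis
      unfolding x_def[abs_def]
      by (rule absolutely_continuous_on_compose_lipschitz)
        (rule lipschitz_on_cmult_real[OF lipschitz_on_id])
  qed
  \<comment> \<open>As \<open>s\<close> does not increase, \<open>Z\<close> contains every time
    after each of its points. Being convex, it has a negligible frontier.\<close>
  have "is_interval Z"
    unfolding is_interval_1 Z_def using s_le order_trans by fastforce
  then have Z: "negligible (frontier Z)"
    by (intro negligible_convex_frontier is_interval_convex)
  let ?N = "{t0} \<union> {t. 0 \<le> t \<and> \<not> continuous (at t within {0..}) u} \<union> frontier Z"
  have N: "negligible ?N"
    using Z piecewise_continuous_negligible_discontinuities[OF pc] by simp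
  have deriv: "(x has_vector_derivative powr_field u p (x t) t) (at t within {t0..})"
    if t: "t \<notin> ?N" "t \<ge> t0" for t
  proof (rule has_vector_derivative_at_within)
    have "t > t0" using t by auto
    show "(x has_vector_derivative powr_field u p (x t) t) (at t)"
    proof (cases "t \<in> interior Z")
      case True
      have x0Z: "x y = 0" if "y \<in> interior Z" for y
        using that interior_subset[of Z] q(1) by (auto simp: Z_def x_def)
      have "(x has_vector_derivative 0) (at t)"
        by (rule has_vector_derivative_transform_within_open[OF has_vector_derivative_const open_interior True])
          (simp add: x0Z)
      then show ?thesis by (simp add: x0Z[OF True] signed_powr_def)
    next
      case False
      \<comment> \<open>Outside the frontier and the interior, \<open>t\<close> is not even in the
        closure.\<close>
      then have "t \<notin> Z" using t(1) closure_subset[of Z] by (auto simp: frontier_def)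
      then have st: "s t > 0" using t(2) by (auto simp: Z_def)
      have "x0 \<noteq> 0" using st s_le[of t0 t] t(2) s_t0 by (auto simp: c_def)
      have "at t within {0..} = at t"
        using \<open>t > t0\<close> \<open>0 \<le> t0\<close> by (intro at_within_interior) (simp add: interior_Ici[of "-1"])
      then have "isCont u t" using t \<open>0 \<le> t0\<close> by auto
      then have "isCont h t"
        unfolding h_def[abs_def]
        by (rule isCont_o2) (use h_cont in \<open>simp add: continuous_on_eq_continuous_at\<close>)
      then have "continuous (at t within {t0..t + 1} - {}) h"
        by (rule continuous_within_subset) simp
      \<comment> \<open>Extending the interval to \<open>t + 1\<close> puts \<open>t\<close> in its
        interior, so the derivative becomes two-sided.\<close>
      then have "((\<lambda>t. integral {t0..t} h) has_vector_derivative h t) (at t within {t0..t + 1} - {})"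
        using \<open>t > t0\<close> by (intro integral_has_vector_derivative_continuous_at[OF int[OF \<open>0 \<le> t0\<close>]]) auto
      then have "((\<lambda>t. integral {t0..t} h) has_real_derivative h t) (at t)"
        using \<open>t > t0\<close> at_within_Icc_at[of t0 t "t + 1"]
        by (simp add: has_real_derivative_iff_has_vector_derivative)
      then have ds: "(s has_real_derivative - ((1 - p) * h t)) (at t)"
        unfolding s_def[abs_def] by (auto intro!: derivative_eq_intros)
      have "((\<lambda>v. v powr q) has_real_derivative q * s t powr (q - 1)) (at (s t))"
        by (rule has_real_derivative_powr[OF st])
      from DERIV_cmult[OF DERIV_chain2[OF this ds], of "sgn x0"]
      have dx: "((\<lambda>t. sgn x0 * s t powr q) has_real_derivative
          sgn x0 * (q * s t powr (q - 1) * - ((1 - p) * h t))) (at t)" .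
      have "(s \<longlongrightarrow> s t) (nhds t)"
        using DERIV_isCont[OF ds] by (simp add: isCont_def tendsto_at_iff_tendsto_nhds)
      then have "eventually (\<lambda>y. s y > 0) (nhds t)" by (rule order_tendstoD(1)[OF _ st])
      then have "eventually (\<lambda>y. x y = sgn x0 * s y powr q) (nhds t)"
        by (rule eventually_mono) (simp add: x_def)
      then have "(x has_real_derivative sgn x0 * (q * s t powr (q - 1) * - ((1 - p) * h t))) (at t)"
        by (rule iffD2[OF DERIV_cong_ev[OF refl _ refl] dx])
      \<comment> \<open>The choice of \<open>q\<close> gives \<open>(1 - p) * q = 1\<close>, and
        \<open>q * p = q - 1\<close> turns \<open>s t powr (q - 1)\<close> into
        \<open>\<bar>x t\<bar> powr p\<close>.\<close>
      also have "sgn x0 * (q * s t powr (q - 1) * - ((1 - p) * h t))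
          = - (h t * s t powr (q - 1) * sgn x0) * ((1 - p) * q)"
        by (simp only: mult_ac mult_minus_left mult_minus_right)
      also have "\<dots> = powr_field u p (x t) t"
      proof -
        have xt: "x t = sgn x0 * s t powr q" using st by (simp add: x_def)
        have "\<bar>x t\<bar> = s t powr q" "sgn (x t) = sgn x0"
          using st \<open>x0 \<noteq> 0\<close> by (auto simp: xt abs_mult sgn_mult)
        then show ?thesis
          by (simp add: signed_powr_mult_self powr_powr q h_def)
      qed
      finally show ?thesis by (simp add: has_real_derivative_iff_has_vector_derivative)
    qed
  qed
  have "AE t in lebesgue. t \<ge> t0 \<longrightarrow>
      (x has_vector_derivative powr_field u p (x t) t) (at t within {t0..})"
    unfolding eventually_ae_filter_negligible using N deriv by (intro exI[of _ ?N]) fast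
  then have "is_solution (powr_field u p) t0 x0 x"
    unfolding is_solution_def using x_t0 AC by (intro conjI allI impI)
  then show ?thesis by (rule exI[of _ x])
qed

theorem theorem1:
  fixes u :: "real \<Rightarrow> real" and T \<epsilon> p :: real
  assumes "persistently_exciting_with u T \<epsilon>"
    and "0 \<le> p" and "p < 1"
  shows "globally_uniformly_finite_time_stable (\<lambda>x t. - signed_powr (u t * x) p * u t) \<and>
    (\<forall>t0\<ge>0. \<forall>x0 x. is_solution (\<lambda>x t. - signed_powr (u t * x) p * u t) t0 x0 x \<longrightarrow>
      (\<forall>t \<ge> t0 + of_int \<lceil>\<bar>x t0\<bar> powr (1 - p) / ((1 - p) * T * \<epsilon> powr (p + 1))\<rceil> * T. x t = 0))"
proof (rule conjI)
  note settle = powr_field_settling_time[OF assms(1) _ assms(2,3)]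
  show "\<forall>t0\<ge>0. \<forall>x0 x. is_solution (powr_field u p) t0 x0 x \<longrightarrow>
      (\<forall>t \<ge> t0 + of_int \<lceil>\<bar>x t0\<bar> powr (1 - p) / ((1 - p) * T * \<epsilon> powr (p + 1))\<rceil> * T. x t = 0)"
    by (intro allI impI) (rule settle)
  have pc: "piecewise_continuous u" and T: "T > 0"
    using assms(1) by (auto simp: persistently_exciting_with_def)
  show "globally_uniformly_finite_time_stable (powr_field u p)"
    unfolding globally_uniformly_finite_time_stable_def
  proof (intro conjI)
    show "\<forall>t\<ge>0. powr_field u p 0 t = 0" by (simp add: signed_powr_def)
    show "\<forall>t0\<ge>0. \<forall>x0. \<exists>x. is_solution (powr_field u p) t0 x0 x"
      using powr_field_solution_exists[OF pc _ assms(2,3)] by blast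
    show "uniformly_stable (powr_field u p)"
      unfolding uniformly_stable_def
    proof (intro allI impI)
      fix e :: real assume "e > 0"
      show "\<exists>d>0. \<forall>t0\<ge>0. \<forall>x0 x. norm x0 < d \<and> is_solution (powr_field u p) t0 x0 x \<longrightarrow>
          (\<forall>t\<ge>t0. norm (x t) < e)"
      \<comment> \<open>Solutions never exceed their initial absolute value, so \<open>e\<close>
        itself serves as the radius for all initial times.\<close>
      proof (intro exI[of _ e] conjI allI impI \<open>e > 0\<close>, elim conjE)
        fix t0 x0 x t
        assume x0: "norm x0 < e" and sol: "is_solution (powr_field u p) t0 x0 x" and t: "t0 \<le> (t::real)"
        have "x t0 = x0" using sol unfolding is_solution_def by (elim conjE)
        then show "norm (x t) < e"
          using powr_field_abs_le_initial[OF sol assms(2,3) t] x0 by simp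
      qed
    qed
    show "\<forall>x0. \<exists>\<tau>\<ge>0. \<forall>t0\<ge>0. \<forall>x. is_solution (powr_field u p) t0 x0 x \<longrightarrow> (\<forall>t\<ge>t0 + \<tau>. x t = 0)"
    proof
      fix x0 :: real
      \<comment> \<open>The bound is written with \<open>x0\<close> rather than \<open>x t0\<close>,
        so that it depends neither on the initial time nor on the solution.\<close>
      let ?\<tau> = "of_int \<lceil>\<bar>x0\<bar> powr (1 - p) / ((1 - p) * T * \<epsilon> powr (p + 1))\<rceil> * T"
      have "0 \<le> \<bar>x0\<bar> powr (1 - p) / ((1 - p) * T * \<epsilon> powr (p + 1))"
        using T assms(3) by simp
      then have "?\<tau> \<ge> 0" using T by simp
      show "\<exists>\<tau>\<ge>0. \<forall>t0\<ge>0. \<forall>x. is_solution (powr_field u p) t0 x0 x \<longrightarrow> (\<forall>t\<ge>t0 + \<tau>. x t = 0)"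
      proof (intro exI[of _ ?\<tau>] conjI allI impI \<open>?\<tau> \<ge> 0\<close>)
        fix t0 x t
        assume "t0 \<ge> 0" and sol: "is_solution (powr_field u p) t0 x0 x" and t: "t \<ge> t0 + ?\<tau>"
        have "x t0 = x0" using sol unfolding is_solution_def by (elim conjE)
        show "x t = 0"
          by (rule settle[OF sol \<open>t0 \<ge> 0\<close>]) (unfold \<open>x t0 = x0\<close>, rule t)
      qed
    qed
  qed
qed

end
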